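(* Let $P$ be a point that does not lie on the extended sides of triangle $ABC$ or of its anticomplementary triangle. If $P$ does not lie on a median of triangle $ABC$, then the affine map $\lambda=T_{P'}\circ T_P^{-1}$ takes the conic $\mathcal{C}_P$ to itself: $\lambda(\mathcal{C}_P)=\mathcal{C}_P$.
   Context: Work in the extended Euclidean plane: the Euclidean plane together with the line at infinity $l_\infty$. Points on $l_\infty$ are called infinite, all other points ordinary; affine maps are extended to $l_\infty$. $XY$ denotes the line through $X$ and $Y$, and $l\cdot m$ the intersection point of lines $l$ and $m$. $ABC$ is a (nondegenerate) triangle with centroid $G$; medians are the full lines $AG,BG,CG$. $K$ is the homothety with center $G$ and ratio $-1/2$; the anticomplementary triangle is $K^{-1}(ABC)$. $P$ may be ordinary or infinite. $D=AP\cdot BC$, $E=BP\cdot CA$, $F=CP\cdot AB$ are the traces of $P$, and $D_3,E_3,F_3$ are their reflections in the midpoints of $BC,CA,AB$ respectively; the lines $AD_3,BE_3,CF_3$ meet in the isotomic conjugate $P'$ of $P$. Put $Q=K(P')$, $Q'=K(P)$. $T_P$ is the unique affine map with $A\mapsto D$, $B\mapsto E$, $C\mapsto F$; $T_{P'}$ is the unique affine map with $A\mapsto D_3$, $B\mapsto E_3$, $C\mapsto F_3$. $\mathcal{C}_P$ is the (nondegenerate) conic through the five points $A,B,C,P,Q$; it also passes through $P'$ and $Q'$. *)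

theory Defs
  imports "HOL-Analysis.Analysis"
begin

text \<open>An infinite point is the common direction of a class of parallel lines, i.e. a
  one-dimensional subspace of the plane.\<close>

typedef direction = "{S :: (real^2) set. subspace S \<and> dim S = 1}"
proof
  show "span {axis 1 1 :: real^2} \<in> {S. subspace S \<and> dim S = 1}"
    by (simp add: dim_insert axis_eq_0_iff)
qed

text \<open>Only meaningful for nonzero \<open>v\<close>.\<close>

definition direction_of :: "real^2 \<Rightarrow> direction" where
  "direction_of v = Abs_direction (span {v})"

datatype point = Ordinary "real^2" | Infinite direction

definition line_at_infinity :: "point set" where
  "line_at_infinity = range Infinite"

definition is_line :: "point set \<Rightarrow> bool" where
  "is_line l \<longleftrightarrow>
     l = line_at_infinity \<or>
     (\<exists>p v. v \<noteq> 0 \<and> l = insert (Infinite (direction_of v)) (range (\<lambda>t. Ordinary (p + t *\<^sub>R v))))"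

definition line_through :: "point \<Rightarrow> point \<Rightarrow> point set" where
  "line_through X Y = (THE l. is_line l \<and> X \<in> l \<and> Y \<in> l)"

definition line_meet :: "point set \<Rightarrow> point set \<Rightarrow> point" where
  "line_meet l m = (THE X. X \<in> l \<and> X \<in> m)"

definition affine_map :: "(real^2 \<Rightarrow> real^2) \<Rightarrow> bool" where
  "affine_map f \<longleftrightarrow> (\<exists>h b. linear h \<and> f = (\<lambda>x. h x + b))"

text \<open>The extension of an affine map acts on directions through its linear part
  \<open>\<lambda>v. f v - f 0\<close>; this is only meaningful for injective \<open>f\<close>.\<close>

fun extend :: "(real^2 \<Rightarrow> real^2) \<Rightarrow> point \<Rightarrow> point" where
  "extend f (Ordinary p) = Ordinary (f p)"
| "extend f (Infinite d) = Infinite (Abs_direction ((\<lambda>v. f v - f 0) ` Rep_direction d))"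

text \<open>A conic is given in homogeneous coordinates by a symmetric matrix \<open>M\<close>; an ordinary point
  has coordinates \<open>(x, y, 1)\<close> and the direction spanned by \<open>(x, y)\<close> has coordinates
  \<open>(x, y, 0)\<close>.\<close>

definition quadratic_form :: "real^3^3 \<Rightarrow> real^3 \<Rightarrow> real" where
  "quadratic_form M w = w \<bullet> (M *v w)"

fun on_conic :: "real^3^3 \<Rightarrow> point \<Rightarrow> bool" where
  "on_conic M (Ordinary p) \<longleftrightarrow> quadratic_form M (vector [p$1, p$2, 1]) = 0"
| "on_conic M (Infinite d) \<longleftrightarrow>
     (\<forall>v\<in>Rep_direction d. quadratic_form M (vector [v$1, v$2, 0]) = 0)"

definition nondegenerate_conic :: "point set \<Rightarrow> bool" where
  "nondegenerate_conic C \<longleftrightarrow>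
     (\<exists>M. transpose M = M \<and> det M \<noteq> 0 \<and> C = {X. on_conic M X})"

definition centroid :: "real^2 \<Rightarrow> real^2 \<Rightarrow> real^2 \<Rightarrow> real^2" where
  "centroid A B C = (1/3) *\<^sub>R (A + B + C)"

definition homothety :: "real^2 \<Rightarrow> real \<Rightarrow> real^2 \<Rightarrow> real^2" where
  "homothety Z r X = Z + r *\<^sub>R (X - Z)"

definition point_reflection :: "real^2 \<Rightarrow> real^2 \<Rightarrow> real^2" where
  "point_reflection M X = 2 *\<^sub>R M - X"

definition K_map :: "real^2 \<Rightarrow> real^2 \<Rightarrow> real^2 \<Rightarrow> real^2 \<Rightarrow> real^2" where
  "K_map A B C = homothety (centroid A B C) (-1/2)"

definition sides :: "real^2 \<Rightarrow> real^2 \<Rightarrow> real^2 \<Rightarrow> point set" where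
  "sides A B C = line_through (Ordinary B) (Ordinary C)
     \<union> line_through (Ordinary C) (Ordinary A)
     \<union> line_through (Ordinary A) (Ordinary B)"

definition anticomplementary_sides :: "real^2 \<Rightarrow> real^2 \<Rightarrow> real^2 \<Rightarrow> point set" where
  "anticomplementary_sides A B C =
     (let K = K_map A B C in sides (inv K A) (inv K B) (inv K C))"

definition medians :: "real^2 \<Rightarrow> real^2 \<Rightarrow> real^2 \<Rightarrow> point set" where
  "medians A B C =
     (let G = Ordinary (centroid A B C) in
        line_through (Ordinary A) G \<union> line_through (Ordinary B) G \<union> line_through (Ordinary C) G)"

text \<open>The trace on the side opposite to the first vertex, and its reflection in the midpoint of
  that side; the other two are obtained by permuting \<open>A\<close>, \<open>B\<close>, \<open>C\<close> cyclically.\<close>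

definition cevian_trace :: "real^2 \<Rightarrow> real^2 \<Rightarrow> real^2 \<Rightarrow> point \<Rightarrow> point" where
  "cevian_trace A B C P =
     line_meet (line_through (Ordinary A) P) (line_through (Ordinary B) (Ordinary C))"

definition reflected_trace :: "real^2 \<Rightarrow> real^2 \<Rightarrow> real^2 \<Rightarrow> point \<Rightarrow> point" where
  "reflected_trace A B C P = extend (point_reflection (midpoint B C)) (cevian_trace A B C P)"

definition isotomic_conjugate :: "real^2 \<Rightarrow> real^2 \<Rightarrow> real^2 \<Rightarrow> point \<Rightarrow> point" where
  "isotomic_conjugate A B C P =
     (THE X. X \<in> line_through (Ordinary A) (reflected_trace A B C P) \<and>
             X \<in> line_through (Ordinary B) (reflected_trace B C A P) \<and>
             X \<in> line_through (Ordinary C) (reflected_trace C A B P))"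

definition affine_map_taking ::
    "real^2 \<Rightarrow> real^2 \<Rightarrow> real^2 \<Rightarrow> point \<Rightarrow> point \<Rightarrow> point \<Rightarrow> real^2 \<Rightarrow> real^2" where
  "affine_map_taking A B C X Y Z =
     (THE T. affine_map T \<and> Ordinary (T A) = X \<and> Ordinary (T B) = Y \<and> Ordinary (T C) = Z)"

text \<open>\<open>T_map\<close> is \<open>T\<^sub>P\<close>, and \<open>T_map'\<close> is the map \<open>T\<^sub>P\<^sub>'\<close> for the isotomic conjugate \<open>P'\<close> of \<open>P\<close>,
  given in terms of \<open>P\<close>: the traces of \<open>P'\<close> are the reflected traces of \<open>P\<close>.\<close>

definition T_map :: "real^2 \<Rightarrow> real^2 \<Rightarrow> real^2 \<Rightarrow> point \<Rightarrow> real^2 \<Rightarrow> real^2" where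
  "T_map A B C P =
     affine_map_taking A B C (cevian_trace A B C P) (cevian_trace B C A P) (cevian_trace C A B P)"

definition T_map' :: "real^2 \<Rightarrow> real^2 \<Rightarrow> real^2 \<Rightarrow> point \<Rightarrow> real^2 \<Rightarrow> real^2" where
  "T_map' A B C P =
     affine_map_taking A B C
       (reflected_trace A B C P) (reflected_trace B C A P) (reflected_trace C A B P)"

definition conic_C :: "real^2 \<Rightarrow> real^2 \<Rightarrow> real^2 \<Rightarrow> point \<Rightarrow> point set" where
  "conic_C A B C P =
     (let Q = extend (K_map A B C) (isotomic_conjugate A B C P) in
        THE S. nondegenerate_conic S \<and> {Ordinary A, Ordinary B, Ordinary C, P, Q} \<subseteq> S)"

end

theory Submission
  imports Defs
begin

text \<open>The proof is a computation in homogeneous barycentric coordinates with respect to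
  \<open>ABC\<close>. They treat ordinary and infinite points alike: a triple other than zero is a point,
  and the sum of its entries vanishes exactly when the point is infinite. Let \<open>P = (p : q : r)\<close>.
  The three hypotheses on \<open>P\<close> say that \<open>p, q, r\<close> do not vanish
  (\<open>mem_sides_iff\<close>), that no two of them have sum zero (\<open>mem_anticomplementary_sides_iff\<close>) and
  that they are distinct (\<open>mem_medians_iff\<close>).

  The traces of \<open>P\<close> are \<open>(0 : q : r)\<close>, \<open>(p : 0 : r)\<close>, \<open>(p : q : 0)\<close>, those of \<open>P'\<close> arise by
  exchanging the two coordinates other than 0, and all six are ordinary because no sum vanishes.
  From \<open>P' = (qr : rp : pq)\<close> one gets \<open>Q = (p(q + r) : q(r + p) : r(p + q))\<close>. A conic through
  \<open>A\<close>, \<open>B\<close>, \<open>C\<close> has an equation \<open>a yz + b zx + c xy = 0\<close>, and passing through \<open>P\<close> and \<open>Q\<close>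
  determines \<open>(a : b : c)\<close>. Hence \<open>C\<^sub>P\<close> is (\<open>conic_C_bary\<close>)
  \<open>p (q\<^sup>2 - r\<^sup>2) yz + q (r\<^sup>2 - p\<^sup>2) zx + r (p\<^sup>2 - q\<^sup>2) xy = 0\<close>.

  The point of the proof is that \<open>T\<^sub>P\<close> and \<open>T\<^sub>P\<^sub>'\<close> pull this conic back to the same conic. Take
  \<open>((q + r) x : (r + p) y : (p + q) z)\<close> as coordinates of the argument; the weights cancel the
  denominators of the traces. Then, in coordinates with respect to \<open>ABC\<close>, the two maps are
    \<open>(x, y, z) \<mapsto> (p (y + z), q (z + x), r (x + y))\<close> and
    \<open>(x, y, z) \<mapsto> (r y + q z, p z + r x, q x + p y)\<close>.
  Substituting either of them into the equation of \<open>C\<^sub>P\<close> cancels the mixed terms and gives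
  \<open>pqr ((q\<^sup>2 - r\<^sup>2) x\<^sup>2 + (r\<^sup>2 - p\<^sup>2) y\<^sup>2 + (p\<^sup>2 - q\<^sup>2) z\<^sup>2)\<close>, a form that is diagonal
  (\<open>circumconic_parametrizations\<close>). So \<open>T\<^sub>P\<close> and \<open>T\<^sub>P\<^sub>'\<close> both map the conic where this form
  vanishes onto \<open>C\<^sub>P\<close>, and \<open>\<lambda> = T\<^sub>P\<^sub>' \<circ> T\<^sub>P\<^sup>-\<^sup>1\<close> maps \<open>C\<^sub>P\<close> onto itself.

  The rest translates the synthetic definitions into coordinates: a line of the extended plane is
  the zero set of a linear form (\<open>is_line_iff\<close>), an affine map acts by keeping the barycentric
  coordinates and moving the reference triangle (\<open>extend_bary\<close>), and an affine map is determined
  by the images of three noncollinear points (\<open>affine_map_eqI\<close>).\<close>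

section \<open>Homogeneous coordinates on the extended plane\<close>

lemma vector_2_eq_iff: "v = w \<longleftrightarrow> v$1 = w$1 \<and> v$2 = w$2" for v w :: "real^2"
  by (simp add: vec_eq_iff forall_2)

lemma vector_3_eq_iff: "v = w \<longleftrightarrow> v$1 = w$1 \<and> v$2 = w$2 \<and> v$3 = w$3" for v w :: "real^3"
  by (simp add: vec_eq_iff forall_3)

lemma inner_3: "v \<bullet> w = v$1 * w$1 + v$2 * w$2 + v$3 * w$3" for v w :: "real^3"
  by (simp add: inner_vec_def sum_3)

lemma Rep_direction_of: "Rep_direction (direction_of v) = span {v}" if "v \<noteq> 0"
  unfolding direction_of_def using that by (intro Abs_direction_inverse) (simp add: dim_insert)

lemma direction_of_scale: "direction_of (k *\<^sub>R v) = direction_of v" if "k \<noteq> 0"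
  unfolding direction_of_def using that span_image_scale[of "{v}" "\<lambda>_. k"] by simp

lemma direction_of_eq_imp:
  assumes "direction_of v = direction_of w" "v \<noteq> 0" "w \<noteq> 0"
  shows "\<exists>k. v = k *\<^sub>R w"
proof -
  have "span {v} = span {w}" using assms Rep_direction_of by metis
  then have "v \<in> span {w}" using span_base by blast
  then show ?thesis by (auto simp: span_singleton)
qed

lemma direction_cases: obtains v where "v \<noteq> 0" "d = direction_of v"
proof -
  have "subspace (Rep_direction d)" "dim (Rep_direction d) = 1" using Rep_direction[of d] by auto
  then obtain B where B: "B \<subseteq> Rep_direction d" "independent B" "Rep_direction d = span B" "card B = 1"
    by (metis basis_subspace_exists)
  then obtain v where "B = {v}" by (auto simp: card_1_singleton_iff)
  with B have "v \<noteq> 0" "d = direction_of v"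
    unfolding direction_of_def using Rep_direction_inverse by (auto, metis)
  then show ?thesis by (rule that)
qed

definition point_of :: "real^3 \<Rightarrow> point" where
  "point_of w = (if w$3 = 0 then Infinite (direction_of (vector [w$1, w$2]))
                 else Ordinary (vector [w$1 / w$3, w$2 / w$3]))"

definition lift :: "real^2 \<Rightarrow> real^3" where
  "lift X = vector [X$1, X$2, 1]"

lemma lift_nth [simp]: "lift X $ 1 = X$1" "lift X $ 2 = X$2" "lift X $ 3 = 1"
  by (simp_all add: lift_def)

lemma point_of_lift [simp]: "point_of (lift X) = Ordinary X"
  by (simp add: point_of_def lift_def vector_2_eq_iff)

lemma point_of_scale: "point_of (k *\<^sub>R w) = point_of w" if "k \<noteq> 0"
proof -
  have "vector [k * w$1, k * w$2] = k *\<^sub>R (vector [w$1, w$2] :: real^2)"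
    by (simp add: vector_2_eq_iff)
  then show ?thesis using that by (simp add: point_of_def direction_of_scale)
qed

lemma point_of_eq_imp:
  assumes "point_of v = point_of w" "v \<noteq> 0" "w \<noteq> 0"
  obtains k where "k \<noteq> 0" "v = k *\<^sub>R w"
proof (cases "w$3 = 0")
  case True
  then have 0: "v$3 = 0" using assms(1) by (auto simp: point_of_def split: if_splits)
  let ?v = "vector [v$1, v$2] :: real^2" and ?w = "vector [w$1, w$2] :: real^2"
  have "?v \<noteq> 0" "?w \<noteq> 0" using assms 0 True by (auto simp: vector_2_eq_iff vector_3_eq_iff)
  moreover have "direction_of ?v = direction_of ?w"
    using assms(1) 0 True by (simp add: point_of_def)
  ultimately obtain k where "?v = k *\<^sub>R ?w" using direction_of_eq_imp by blast
  then have "v = k *\<^sub>R w" using 0 True by (simp add: vector_2_eq_iff vector_3_eq_iff)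
  then show ?thesis using that assms(2) by auto
next
  case False
  then have 0: "v$3 \<noteq> 0" using assms(1) by (auto simp: point_of_def split: if_splits)
  have "v$1 / v$3 = w$1 / w$3" "v$2 / v$3 = w$2 / w$3"
    using assms(1) 0 False by (auto simp: point_of_def vector_2_eq_iff)
  then have "v = (v$3 / w$3) *\<^sub>R w" using 0 False by (simp add: vector_3_eq_iff field_simps)
  moreover have "v$3 / w$3 \<noteq> 0" using 0 False by simp
  ultimately show ?thesis by (intro that)
qed

lemma point_of_cases: obtains w where "w \<noteq> 0" "X = point_of w"
proof (cases X)
  case (Ordinary p)
  then show ?thesis using that[of "lift p"] by (auto simp: vector_3_eq_iff)
next
  case (Infinite d)
  obtain v where "v \<noteq> 0" "d = direction_of v" by (rule direction_cases)
  then have "vector [v$1, v$2, 0] \<noteq> (0::real^3)"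
    "X = point_of (vector [v$1, v$2, 0])"
    unfolding Infinite point_of_def by (auto simp: vector_2_eq_iff vector_3_eq_iff intro!: arg_cong[of _ _ direction_of])
  then show ?thesis by (rule that)
qed

definition line_of :: "real^3 \<Rightarrow> point set" where
  "line_of a = {point_of w | w. w \<noteq> 0 \<and> a \<bullet> w = 0}"

lemma point_of_mem_line_of:
  assumes "w \<noteq> 0"
  shows "point_of w \<in> line_of a \<longleftrightarrow> a \<bullet> w = 0"
proof
  assume "point_of w \<in> line_of a"
  then obtain v where v: "point_of w = point_of v" "v \<noteq> 0" "a \<bullet> v = 0" by (auto simp: line_of_def)
  obtain k where "w = k *\<^sub>R v" using v(1) assms v(2) by (rule point_of_eq_imp)
  then show "a \<bullet> w = 0" using v by simp
qed (use assms in \<open>auto simp: line_of_def\<close>)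

lemma line_of_scale: "line_of (k *\<^sub>R a) = line_of a" if "k \<noteq> 0"
  using that by (simp add: line_of_def)

lemma line_of_eq_line_at_infinity: "line_of (axis 3 1) = line_at_infinity"
proof -
  have "X \<in> line_of (axis 3 1) \<longleftrightarrow> X \<in> line_at_infinity" for X
  proof -
    obtain w where "w \<noteq> 0" "X = point_of w" by (rule point_of_cases)
    then have "X \<in> line_of (axis 3 1) \<longleftrightarrow> w$3 = 0"
      by (simp add: point_of_mem_line_of inner_axis')
    then show ?thesis
      using \<open>X = point_of w\<close> by (auto simp: line_at_infinity_def point_of_def)
  qed
  then show ?thesis by blast
qed

text \<open>The linear form is \<open>x \<mapsto> det (v, x - p)\<close> made homogeneous; on a direction \<open>u\<close> its value is
  \<open>det (v, u)\<close>.\<close>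

lemma line_of_eq_affine_line:
  assumes "v \<noteq> 0"
  shows "line_of (vector [- v$2, v$1, v$2 * p$1 - v$1 * p$2])
         = insert (Infinite (direction_of v)) (range (\<lambda>t. Ordinary (p + t *\<^sub>R v)))" (is "line_of ?a = ?l")
proof -
  have "X \<in> line_of ?a \<longleftrightarrow> X \<in> ?l" for X
  proof (cases X)
    case (Ordinary x)
    have "X \<in> line_of ?a \<longleftrightarrow> ?a \<bullet> lift x = 0"
      unfolding Ordinary point_of_lift[symmetric]
      by (rule point_of_mem_line_of) (simp add: vector_3_eq_iff)
    also have "\<dots> \<longleftrightarrow> v$1 * (x$2 - p$2) = v$2 * (x$1 - p$1)"
      by (simp add: inner_3 algebra_simps)
    also have "\<dots> \<longleftrightarrow> (\<exists>t. x = p + t *\<^sub>R v)"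
    proof
      assume *: "v$1 * (x$2 - p$2) = v$2 * (x$1 - p$1)"
      show "\<exists>t. x = p + t *\<^sub>R v"
      proof (cases "v$1 = 0")
        case True
        then have "v$2 \<noteq> 0" using assms by (simp add: vector_2_eq_iff)
        then show ?thesis using True *
          by (intro exI[of _ "(x$2 - p$2) / v$2"]) (simp add: vector_2_eq_iff)
      next
        case False
        then show ?thesis using *
          by (intro exI[of _ "(x$1 - p$1) / v$1"]) (simp add: vector_2_eq_iff field_simps)
      qed
    qed (auto simp: algebra_simps)
    finally show ?thesis unfolding Ordinary by auto
  next
    case (Infinite d)
    obtain u where u: "u \<noteq> 0" "d = direction_of u" by (rule direction_cases)
    let ?u = "vector [u$1, u$2, 0] :: real^3"
    have X: "X = point_of ?u" unfolding Infinite u point_of_def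
      by (auto simp: vector_2_eq_iff intro!: arg_cong[of _ _ direction_of])
    have "?u \<noteq> 0" using u by (auto simp: vector_2_eq_iff vector_3_eq_iff)
    then have "X \<in> line_of ?a \<longleftrightarrow> v$1 * u$2 = v$2 * u$1"
      unfolding X by (subst point_of_mem_line_of) (auto simp: inner_3)
    also have "\<dots> \<longleftrightarrow> d = direction_of v"
    proof
      assume *: "v$1 * u$2 = v$2 * u$1"
      have "\<exists>k. u = k *\<^sub>R v"
      proof (cases "v$1 = 0")
        case True
        then have "v$2 \<noteq> 0" using assms by (simp add: vector_2_eq_iff)
        then show ?thesis using True *
          by (intro exI[of _ "u$2 / v$2"]) (simp add: vector_2_eq_iff)
      next
        case False
        then show ?thesis using *
          by (intro exI[of _ "u$1 / v$1"]) (simp add: vector_2_eq_iff field_simps)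
      qed
      then obtain k where "u = k *\<^sub>R v" ..
      then show "d = direction_of v" using u direction_of_scale by auto
    next
      assume "d = direction_of v"
      then obtain k where "u = k *\<^sub>R v" using u assms direction_of_eq_imp by metis
      then show "v$1 * u$2 = v$2 * u$1" by simp
    qed
    finally show ?thesis unfolding Infinite by auto
  qed
  then show ?thesis by blast
qed

text \<open>Both the affine lines and the line at infinity are zero sets of linear forms, so that
  all questions of incidence become linear algebra in three dimensions.\<close>

lemma is_line_iff: "is_line l \<longleftrightarrow> (\<exists>a\<noteq>0. l = line_of a)"
proof
  assume "is_line l"
  then consider "l = line_at_infinity"
    | p v where "v \<noteq> 0" "l = insert (Infinite (direction_of v)) (range (\<lambda>t. Ordinary (p + t *\<^sub>R v)))"
    unfolding is_line_def by blast
  then show "\<exists>a\<noteq>0. l = line_of a"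
  proof cases
    case 1
    moreover have "axis 3 1 \<noteq> (0::real^3)" by (simp add: axis_eq_0_iff)
    ultimately show ?thesis using line_of_eq_line_at_infinity by blast
  next
    case (2 p v)
    then have "l = line_of (vector [- v$2, v$1, v$2 * p$1 - v$1 * p$2])"
      by (simp add: line_of_eq_affine_line)
    moreover have "vector [- v$2, v$1, v$2 * p$1 - v$1 * p$2] \<noteq> (0::real^3)"
      using 2 by (auto simp: vector_2_eq_iff vector_3_eq_iff)
    ultimately show ?thesis by blast
  qed
next
  assume "\<exists>a\<noteq>0. l = line_of a"
  then obtain a where a: "a \<noteq> 0" "l = line_of a" by blast
  show "is_line l"
  proof (cases "a$1 = 0 \<and> a$2 = 0")
    case True
    then have "a = (a$3) *\<^sub>R axis 3 1" "a$3 \<noteq> 0"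
      using a by (auto simp: vector_3_eq_iff axis_def)
    then have "line_of a = line_of (axis 3 1)"
      using line_of_scale by metis
    then have "l = line_at_infinity"
      unfolding a(2) line_of_eq_line_at_infinity .
    then show ?thesis by (simp add: is_line_def)
  next
    case False
    (* The direction of the line, and the foot of the perpendicular from the origin. *)
    let ?v = "vector [a$2, - a$1] :: real^2"
    let ?s = "(a$1)\<^sup>2 + (a$2)\<^sup>2"
    let ?p = "(- a$3 / ?s) *\<^sub>R (vector [a$1, a$2] :: real^2)"
    have s: "?s \<noteq> 0" using False by (auto simp: sum_power2_eq_zero_iff)
    have "?v$2 * ?p$1 - ?v$1 * ?p$2 = a$3 * ?s / ?s"
      by (simp add: power2_eq_square distrib_left mult_ac flip: add_divide_distrib)
    also have "\<dots> = a$3" using s by simp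
    finally have "vector [- ?v$2, ?v$1, ?v$2 * ?p$1 - ?v$1 * ?p$2] = a"
      unfolding vector_3_eq_iff by simp
    moreover have "?v \<noteq> 0" using False by (auto simp: vector_2_eq_iff)
    ultimately have "l = insert (Infinite (direction_of ?v)) (range (\<lambda>t. Ordinary (?p + t *\<^sub>R ?v)))"
      using a(2) line_of_eq_affine_line[of ?v ?p] by metis
    moreover have "?v \<noteq> 0" using False by (auto simp: vector_2_eq_iff)
    ultimately show ?thesis unfolding is_line_def by blast
  qed
qed

text \<open>If a form \<open>a\<close> vanishes at \<open>v\<close> and \<open>w\<close>, Lagrange's identity makes its cross product with
  \<open>v \<times> w\<close> vanish, so \<open>a\<close> is a multiple of \<open>v \<times> w\<close>; this is the uniqueness of the line.\<close>

lemma line_through_point_of: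
  assumes "cross3 v w \<noteq> 0"
  shows "line_through (point_of v) (point_of w) = line_of (cross3 v w)"
  unfolding line_through_def
proof (rule the_equality)
  have vw: "v \<noteq> 0" "w \<noteq> 0" using assms by auto
  then show "is_line (line_of (cross3 v w)) \<and> point_of v \<in> line_of (cross3 v w) \<and> point_of w \<in> line_of (cross3 v w)"
    using assms by (auto simp: is_line_iff point_of_mem_line_of dot_cross_self inner_commute[of "cross3 v w" v])
  fix l assume l: "is_line l \<and> point_of v \<in> l \<and> point_of w \<in> l"
  then obtain a where a: "a \<noteq> 0" "l = line_of a" by (auto simp: is_line_iff)
  then have "a \<bullet> v = 0" "a \<bullet> w = 0" using l vw by (auto simp: point_of_mem_line_of)
  then have "cross3 a (cross3 v w) = 0" by (simp add: Lagrange)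
  then obtain k where "a = k *\<^sub>R cross3 v w"
    using a assms by (metis cross_eq_0 collinear_lemma cross_skew neg_0_equal_iff_equal)
  then show "l = line_of (cross3 v w)" using a line_of_scale by auto
qed

section \<open>Barycentric coordinates\<close>

definition bary :: "real^2 \<Rightarrow> real^2 \<Rightarrow> real^2 \<Rightarrow> real \<Rightarrow> real \<Rightarrow> real \<Rightarrow> point" where
  "bary A B C x y z = point_of (x *\<^sub>R lift A + y *\<^sub>R lift B + z *\<^sub>R lift C)"

definition triple_product :: "real^3 \<Rightarrow> real^3 \<Rightarrow> real^3 \<Rightarrow> real" where
  "triple_product a b c = cross3 a b \<bullet> c"

lemma triple_product_rotate: "triple_product b c a = triple_product a b c"
  unfolding triple_product_def by (rule cross_triple[symmetric])

text \<open>Up to the factor \<open>triple_product a b c\<close>, the three cross products are the basis dual to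
  \<open>a, b, c\<close>. They serve to read off coordinates with respect to \<open>a, b, c\<close>.\<close>

lemma cross3_dual:
  "cross3 b c \<bullet> a = triple_product a b c \<and> cross3 b c \<bullet> b = 0 \<and> cross3 b c \<bullet> c = 0 \<and>
   cross3 c a \<bullet> a = 0 \<and> cross3 c a \<bullet> b = triple_product a b c \<and> cross3 c a \<bullet> c = 0 \<and>
   cross3 a b \<bullet> a = 0 \<and> cross3 a b \<bullet> b = 0 \<and> cross3 a b \<bullet> c = triple_product a b c"
  using triple_product_rotate[of a b c] triple_product_rotate[of b c a]
  by (simp_all add: triple_product_def dot_cross_self inner_commute[of "cross3 u v" u for u v])

lemma triple_product_combinations:
  "triple_product (x1 *\<^sub>R a + y1 *\<^sub>R b + z1 *\<^sub>R c) (x2 *\<^sub>R a + y2 *\<^sub>R b + z2 *\<^sub>R c) (x3 *\<^sub>R a + y3 *\<^sub>R b + z3 *\<^sub>R c)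
   = ((y1 * z2 - z1 * y2) * x3 + (z1 * x2 - x1 * z2) * y3 + (x1 * y2 - y1 * x2) * z3) * triple_product a b c"
proof -
  have cross: "cross3 (x1 *\<^sub>R a + y1 *\<^sub>R b + z1 *\<^sub>R c) (x2 *\<^sub>R a + y2 *\<^sub>R b + z2 *\<^sub>R c)
    = (y1 * z2 - z1 * y2) *\<^sub>R cross3 b c + (z1 * x2 - x1 * z2) *\<^sub>R cross3 c a
      + (x1 * y2 - y1 * x2) *\<^sub>R cross3 a b"
    using cross_skew[of b a] cross_skew[of c b] cross_skew[of a c]
    by (simp add: cross_add_left cross_add_right cross_mult_left cross_mult_right algebra_simps)
  show ?thesis
    unfolding triple_product_def[of "x1 *\<^sub>R a + y1 *\<^sub>R b + z1 *\<^sub>R c"] cross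
    by (simp add: inner_add_left inner_add_right cross3_dual[of b c a] algebra_simps)
qed

lemma bary_scale: "bary A B C (k * x) (k * y) (k * z) = bary A B C x y z" if "k \<noteq> 0"
proof -
  have "(k * x) *\<^sub>R lift A + (k * y) *\<^sub>R lift B + (k * z) *\<^sub>R lift C
    = k *\<^sub>R (x *\<^sub>R lift A + y *\<^sub>R lift B + z *\<^sub>R lift C)" by (simp add: scaleR_add_right)
  then show ?thesis unfolding bary_def using point_of_scale[OF that] by simp
qed

lemma bary_rotate: "bary A B C x y z = bary B C A y z x"
  by (simp add: bary_def algebra_simps)

lemma bary_rotate': "bary A B C x y z = bary C A B z x y"
  by (simp add: bary_def algebra_simps)

lemma bary_vertex [simp]: "bary A B C 1 0 0 = Ordinary A" "bary A B C 0 1 0 = Ordinary B"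
  "bary A B C 0 0 1 = Ordinary C"
  by (simp_all add: bary_def)

lemma bary_eq:
  "bary A B C x y z = (if x + y + z = 0 then Infinite (direction_of (x *\<^sub>R A + y *\<^sub>R B + z *\<^sub>R C))
     else Ordinary ((1 / (x + y + z)) *\<^sub>R (x *\<^sub>R A + y *\<^sub>R B + z *\<^sub>R C)))"
proof -
  have "vector [x * A$1 + y * B$1 + z * C$1, x * A$2 + y * B$2 + z * C$2]
    = x *\<^sub>R A + y *\<^sub>R B + z *\<^sub>R C" by (simp add: vector_2_eq_iff)
  then show ?thesis by (simp add: bary_def point_of_def) (simp add: vector_2_eq_iff)
qed

text \<open>For lifted points the triple product is twice the signed area, so the assumption is
  noncollinearity in the form in which computations use it.\<close>

locale triangle =
  fixes A B C :: "real^2"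
  assumes triple_lift_nonzero: "triple_product (lift A) (lift B) (lift C) \<noteq> 0"
begin

lemma rotate: "triangle B C A"
  by unfold_locales (use triple_lift_nonzero in \<open>simp add: triple_product_rotate[of "lift B"]\<close>)

lemma combination_eq_0_iff:
  "x *\<^sub>R lift A + y *\<^sub>R lift B + z *\<^sub>R lift C = 0 \<longleftrightarrow> x = 0 \<and> y = 0 \<and> z = 0"
proof
  assume *: "x *\<^sub>R lift A + y *\<^sub>R lift B + z *\<^sub>R lift C = 0"
  have "(y1 * z2 - z1 * y2) * x + (z1 * x2 - x1 * z2) * y + (x1 * y2 - y1 * x2) * z = 0"
    for x1 y1 z1 x2 y2 z2
    using triple_product_combinations[of x1 "lift A" y1 "lift B" z1 "lift C" x2 y2 z2 x y z]
      triple_lift_nonzero by (simp add: * triple_product_def)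
  from this[of 0 1 0 0 0 1] this[of 0 0 1 1 0 0] this[of 1 0 0 0 1 0]
  show "x = 0 \<and> y = 0 \<and> z = 0" by simp
qed simp

lemma combination_cases:
  obtains x y z where "w = x *\<^sub>R lift A + y *\<^sub>R lift B + z *\<^sub>R lift C"
proof -
  let ?a = "lift A" and ?b = "lift B" and ?c = "lift C"
  let ?d = "triple_product ?a ?b ?c"
  have "?d *\<^sub>R w = triple_product ?b ?c w *\<^sub>R ?a + triple_product ?c ?a w *\<^sub>R ?b + triple_product ?a ?b w *\<^sub>R ?c"
    unfolding triple_product_def vector_3_eq_iff inner_3 by (simp add: cross_components algebra_simps)
  then have "(1 / ?d) *\<^sub>R (?d *\<^sub>R w) = (triple_product ?b ?c w / ?d) *\<^sub>R ?a + (triple_product ?c ?a w / ?d) *\<^sub>R ?b + (triple_product ?a ?b w / ?d) *\<^sub>R ?c"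
    by (simp add: scaleR_add_right)
  then have "w = (triple_product ?b ?c w / ?d) *\<^sub>R ?a + (triple_product ?c ?a w / ?d) *\<^sub>R ?b + (triple_product ?a ?b w / ?d) *\<^sub>R ?c"
    using triple_lift_nonzero by simp
  then show ?thesis by (rule that)
qed

lemma bary_cases:
  obtains x y z where "x \<noteq> 0 \<or> y \<noteq> 0 \<or> z \<noteq> 0" "X = bary A B C x y z"
proof -
  obtain w where w: "w \<noteq> 0" "X = point_of w" by (rule point_of_cases)
  obtain x y z where "w = x *\<^sub>R lift A + y *\<^sub>R lift B + z *\<^sub>R lift C" by (rule combination_cases)
  with w have "X = bary A B C x y z" "x \<noteq> 0 \<or> y \<noteq> 0 \<or> z \<noteq> 0" by (auto simp: bary_def)
  then show ?thesis using that by blast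
qed

text \<open>The lifts multiply the determinant of three coordinate triples by the constant
  \<open>triple_product (lift A) (lift B) (lift C)\<close>, so collinearity is the same determinant condition as in
  Cartesian homogeneous coordinates.\<close>

lemma bary_mem_line_through_iff:
  assumes "x1 * y2 \<noteq> y1 * x2 \<or> y1 * z2 \<noteq> z1 * y2 \<or> z1 * x2 \<noteq> x1 * z2"
    and "x \<noteq> 0 \<or> y \<noteq> 0 \<or> z \<noteq> 0"
  shows "bary A B C x y z \<in> line_through (bary A B C x1 y1 z1) (bary A B C x2 y2 z2) \<longleftrightarrow>
    (y1 * z2 - z1 * y2) * x + (z1 * x2 - x1 * z2) * y + (x1 * y2 - y1 * x2) * z = 0"
proof -
  let ?l = "\<lambda>x y z. x *\<^sub>R lift A + y *\<^sub>R lift B + z *\<^sub>R lift C"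
  let ?n = "cross3 (?l x1 y1 z1) (?l x2 y2 z2)"
  have n: "?n \<bullet> ?l x y z = ((y1 * z2 - z1 * y2) * x + (z1 * x2 - x1 * z2) * y + (x1 * y2 - y1 * x2) * z)
      * triple_product (lift A) (lift B) (lift C)" for x y z
    using triple_product_combinations by (simp add: triple_product_def)
  have "?n \<noteq> 0"
    using n[of 1 0 0] n[of 0 1 0] n[of 0 0 1] assms(1) triple_lift_nonzero by auto
  then show ?thesis
    using assms(2) triple_lift_nonzero
    by (simp add: bary_def line_through_point_of point_of_mem_line_of n combination_eq_0_iff)
qed

end

lemma triangle_if_not_collinear:
  assumes "\<not> collinear {A, B, C}"
  shows "triangle A B C"
proof
  let ?u = "A - B" and ?v = "C - B"
  show "triple_product (lift A) (lift B) (lift C) \<noteq> 0"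
  proof
    assume "triple_product (lift A) (lift B) (lift C) = 0"
    then have *: "?u$1 * ?v$2 = ?u$2 * ?v$1"
      by (simp add: triple_product_def inner_3 cross_components algebra_simps)
    have "?u = 0 \<or> (\<exists>k. ?v = k *\<^sub>R ?u)"
    proof (cases "?u$1 = 0")
      case True
      then show ?thesis using *
        by (cases "?u$2 = 0") (auto simp: vector_2_eq_iff intro!: exI[of _ "?v$2 / ?u$2"])
    next
      case False
      then have "?v$1 = (?v$1 / ?u$1) * ?u$1" by (simp only: nonzero_divide_mult_cancel_right nonzero_mult_div_cancel_right times_divide_eq_left not_False_eq_True)
      moreover have "(?v$1 / ?u$1) * ?u$2 = ?u$1 * ?v$2 / ?u$1"
        unfolding * times_divide_eq_left by (simp only: mult.commute)
      then have "?v$2 = (?v$1 / ?u$1) * ?u$2"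
        using False by (metis nonzero_mult_div_cancel_left)
      ultimately have "?v = (?v$1 / ?u$1) *\<^sub>R ?u"
        unfolding vector_2_eq_iff vector_scaleR_component real_scaleR_def by blast
      then show ?thesis by blast
    qed
    then have "collinear {A, B, C}"
      by (auto simp: collinear_lemma collinear_3)
    then show False using assms by contradiction
  qed
qed

section \<open>Affine maps in barycentric coordinates\<close>

lemma affine_map_combination:
  assumes "affine_map f"
  obtains h b where "linear h" "\<And>x. f x = h x + b"
    "\<And>A B C x y z. x *\<^sub>R f A + y *\<^sub>R f B + z *\<^sub>R f C = h (x *\<^sub>R A + y *\<^sub>R B + z *\<^sub>R C) + (x + y + z) *\<^sub>R b"
proof -
  obtain h b where h: "linear h" "f = (\<lambda>x. h x + b)" using assms by (auto simp: affine_map_def)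
  then show ?thesis
    by (intro that[of h b]) (simp_all add: linear_add linear_scale algebra_simps)
qed

lemma affine_map_compose: "affine_map (f \<circ> g)" if fg: "affine_map f" "affine_map g"
proof -
  obtain h b where h: "linear h" "f = (\<lambda>x. h x + b)" using fg by (auto simp: affine_map_def)
  obtain k c where k: "linear k" "g = (\<lambda>x. k x + c)" using fg by (auto simp: affine_map_def)
  have "f \<circ> g = (\<lambda>x. (h \<circ> k) x + (h c + b))" using h k by (auto simp: linear_add)
  then show ?thesis using linear_compose[OF k(1) h(1)] unfolding affine_map_def by blast
qed

lemma affine_map_id: "affine_map id"
  unfolding affine_map_def using linear_id by (intro exI[of _ id] exI[of _ 0]) auto

text \<open>The linear part of \<open>f\<close> and its translation combine to a linear map on lifts that sends the
  lifts of \<open>A, B, C\<close> to those of their images. For an infinite point only the linear part enters,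
  as its coordinates have sum zero.\<close>

lemma (in triangle) extend_bary:
  assumes "affine_map f" "x \<noteq> 0 \<or> y \<noteq> 0 \<or> z \<noteq> 0"
  shows "extend f (bary A B C x y z) = bary (f A) (f B) (f C) x y z"
proof -
  obtain h b where h: "linear h" and f: "\<And>x. f x = h x + b"
    and c: "x *\<^sub>R f A + y *\<^sub>R f B + z *\<^sub>R f C = h (x *\<^sub>R A + y *\<^sub>R B + z *\<^sub>R C) + (x + y + z) *\<^sub>R b"
    using affine_map_combination[OF assms(1)] by metis
  let ?v = "x *\<^sub>R A + y *\<^sub>R B + z *\<^sub>R C"
  show ?thesis
  proof (cases "x + y + z = 0")
    case True
    have "?v \<noteq> 0"
    proof
      assume "?v = 0"
      with True have "x *\<^sub>R lift A + y *\<^sub>R lift B + z *\<^sub>R lift C = 0"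
        by (simp add: vector_2_eq_iff vector_3_eq_iff)
      then show False using assms(2) by (simp add: combination_eq_0_iff)
    qed
    have "(\<lambda>v. f v - f 0) = h" using linear_0[OF h] by (auto simp: f)
    then have "extend f (bary A B C x y z) = Infinite (Abs_direction (h ` span {?v}))"
      using True by (simp only: bary_eq if_True extend.simps refl simp_thms Rep_direction_of[OF \<open>?v \<noteq> 0\<close>])
    also have "h ` span {?v} = span {h ?v}" using linear_span_image[OF h, of "{?v}"] by simp
    finally show ?thesis using True by (simp add: bary_eq c direction_of_def)
  next
    case False
    then have "f ((1 / (x + y + z)) *\<^sub>R ?v) = (1 / (x + y + z)) *\<^sub>R (h ?v + (x + y + z) *\<^sub>R b)"
      unfolding f linear_scale[OF h] by (simp only: scaleR_add_right scaleR_scaleR) simp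
    then show ?thesis using False by (simp only: bary_eq if_False c extend.simps)
  qed
qed

lemma (in triangle) affine_map_eqI:
  assumes "affine_map f" "affine_map g" "f A = g A" "f B = g B" "f C = g C"
  shows "f = g"
proof
  fix X
  obtain x y z where "x \<noteq> 0 \<or> y \<noteq> 0 \<or> z \<noteq> 0" "Ordinary X = bary A B C x y z" by (rule bary_cases)
  then have "extend f (Ordinary X) = extend g (Ordinary X)"
    using assms by (simp add: extend_bary del: extend.simps)
  then show "f X = g X" by simp
qed

text \<open>The barycentric coordinates of a point are affine functions of it, given by the dual
  basis; they are used as the coefficients of the prescribed images.\<close>

lemma (in triangle) affine_map_exists:
  obtains f where "affine_map f" "f A = X" "f B = Y" "f C = Z"
proof -
  let ?a = "lift A" and ?b = "lift B" and ?c = "lift C"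
  let ?d = "triple_product ?a ?b ?c"
  have functional: "linear (\<lambda>V :: real^2. ((n$1 * V$1 + n$2 * V$2) / ?d) *\<^sub>R W)" for n :: "real^3" and W :: "real^2"
    by (rule linearI) (simp_all add: algebra_simps add_divide_distrib)
  have "(n \<bullet> lift V / ?d) *\<^sub>R W = ((n$1 * V$1 + n$2 * V$2) / ?d) *\<^sub>R W + (n$3 / ?d) *\<^sub>R W"
    for n V and W :: "real^2"
    by (simp add: inner_3 add_divide_distrib scaleR_add_left)
  then have aff: "affine_map (\<lambda>V. (n \<bullet> lift V / ?d) *\<^sub>R W)" for n and W :: "real^2"
    unfolding affine_map_def using functional by blast
  have add: "affine_map (\<lambda>V. f V + g V)" if fg: "affine_map f" "affine_map g" for f g
  proof -
    obtain h b where "linear h" "f = (\<lambda>x. h x + b)" using fg by (auto simp: affine_map_def)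
    moreover obtain k c where "linear k" "g = (\<lambda>x. k x + c)" using fg by (auto simp: affine_map_def)
    ultimately show ?thesis unfolding affine_map_def
      by (intro exI[of _ "\<lambda>x. h x + k x"] exI[of _ "b + c"]) (auto intro: linear_compose_add)
  qed
  let ?f = "\<lambda>V. (cross3 ?b ?c \<bullet> lift V / ?d) *\<^sub>R X + (cross3 ?c ?a \<bullet> lift V / ?d) *\<^sub>R Y + (cross3 ?a ?b \<bullet> lift V / ?d) *\<^sub>R Z"
  have "cross3 ?b ?c \<bullet> ?a = ?d" "cross3 ?c ?a \<bullet> ?b = ?d" "cross3 ?a ?b \<bullet> ?c = ?d"
    "cross3 ?b ?c \<bullet> ?b = 0" "cross3 ?c ?a \<bullet> ?c = 0" "cross3 ?a ?b \<bullet> ?a = 0"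
    "cross3 ?b ?c \<bullet> ?c = 0" "cross3 ?c ?a \<bullet> ?a = 0" "cross3 ?a ?b \<bullet> ?b = 0"
    using cross3_dual[of ?b ?c ?a] by blast+
  then show ?thesis using triple_lift_nonzero
    by (intro that[of ?f] add aff) simp_all
qed

lemma (in triangle) affine_map_taking:
  obtains f where "affine_map_taking A B C (Ordinary X) (Ordinary Y) (Ordinary Z) = f"
    "affine_map f" "f A = X" "f B = Y" "f C = Z"
proof -
  obtain f where f: "affine_map f" "f A = X" "f B = Y" "f C = Z" by (rule affine_map_exists)
  have "affine_map_taking A B C (Ordinary X) (Ordinary Y) (Ordinary Z) = f"
    unfolding affine_map_taking_def
    by (rule the_equality) (use f affine_map_eqI in auto)
  then show ?thesis using f by (rule that)
qed

section \<open>Traces, isotomic conjugate and complement in coordinates\<close>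

context triangle
begin

text \<open>Sides, cevians and traces are treated for the vertex \<open>A\<close> only; \<open>rotate\<close> and
  \<open>bary_rotate\<close> transfer the results to the other two vertices.\<close>

lemma mem_side_iff:
  assumes "x \<noteq> 0 \<or> y \<noteq> 0 \<or> z \<noteq> 0"
  shows "bary A B C x y z \<in> line_through (Ordinary B) (Ordinary C) \<longleftrightarrow> x = 0"
  using bary_mem_line_through_iff[where ?x1.0 = 0 and ?y1.0 = 1 and ?z1.0 = 0
      and ?x2.0 = 0 and ?y2.0 = 0 and ?z2.0 = 1 and x = x and y = y and z = z] assms by simp

lemma mem_cevian_iff:
  assumes "x \<noteq> 0 \<or> y \<noteq> 0 \<or> z \<noteq> 0" "q \<noteq> 0 \<or> r \<noteq> 0"
  shows "bary A B C x y z \<in> line_through (Ordinary A) (bary A B C p q r) \<longleftrightarrow> q * z = r * y"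
  using bary_mem_line_through_iff[where ?x1.0 = 1 and ?y1.0 = 0 and ?z1.0 = 0
      and ?x2.0 = p and ?y2.0 = q and ?z2.0 = r and x = x and y = y and z = z] assms by simp

lemma cevian_trace_bary:
  assumes "q \<noteq> 0"
  shows "cevian_trace A B C (bary A B C p q r) = bary A B C 0 q r"
  unfolding cevian_trace_def line_meet_def
proof (rule the_equality)
  show "bary A B C 0 q r \<in> line_through (Ordinary A) (bary A B C p q r) \<and>
    bary A B C 0 q r \<in> line_through (Ordinary B) (Ordinary C)"
    using assms by (simp add: mem_cevian_iff mem_side_iff)
  fix X
  assume *: "X \<in> line_through (Ordinary A) (bary A B C p q r) \<and>
    X \<in> line_through (Ordinary B) (Ordinary C)"
  obtain x y z where xyz: "x \<noteq> 0 \<or> y \<noteq> 0 \<or> z \<noteq> 0" "X = bary A B C x y z" by (rule bary_cases)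
  with * assms have "q * z = r * y" "x = 0" by (simp_all add: mem_cevian_iff mem_side_iff)
  with xyz assms have "y \<noteq> 0" "q / y * x = 0" "q / y * y = q" "q / y * z = r"
    by (auto simp: field_simps)
  then show "X = bary A B C 0 q r"
    using bary_scale[of "q / y" A B C x y z] assms xyz by simp
qed

text \<open>The reflection in the midpoint of \<open>BC\<close> is affine and exchanges \<open>B\<close> and \<open>C\<close>.\<close>

lemma reflected_trace_bary:
  assumes "q \<noteq> 0"
  shows "reflected_trace A B C (bary A B C p q r) = bary A B C 0 r q"
proof -
  let ?f = "point_reflection (midpoint B C)"
  have f: "?f X = - X + (B + C)" for X by (simp add: point_reflection_def midpoint_def)
  then have "affine_map ?f"
    unfolding affine_map_def using linear_uminus by (intro exI[of _ uminus] exI[of _ "B + C"]) auto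
  then have "reflected_trace A B C (bary A B C p q r) = bary (?f A) (?f B) (?f C) 0 q r"
    using assms by (simp add: reflected_trace_def cevian_trace_bary extend_bary)
  also have "\<dots> = bary A B C 0 r q" by (simp add: f bary_def add.commute)
  finally show ?thesis .
qed

text \<open>The three cevians through the reflected traces have the equations \<open>rz = qy\<close>, \<open>px = rz\<close>,
  \<open>qy = px\<close>; so \<open>(x : y : z)\<close> is proportional to \<open>(1/p : 1/q : 1/r)\<close>, here multiplied by
  \<open>pqr\<close>.\<close>

lemma isotomic_conjugate_bary:
  assumes "p \<noteq> 0" "q \<noteq> 0" "r \<noteq> 0"
  shows "isotomic_conjugate A B C (bary A B C p q r) = bary A B C (q * r) (r * p) (p * q)"
proof -
  interpret BCA: triangle B C A by (rule rotate)
  interpret CAB: triangle C A B by (rule BCA.rotate)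
  let ?P = "bary A B C p q r"
  have on_cevians: "bary A B C x y z \<in> line_through (Ordinary A) (reflected_trace A B C ?P) \<and>
      bary A B C x y z \<in> line_through (Ordinary B) (reflected_trace B C A ?P) \<and>
      bary A B C x y z \<in> line_through (Ordinary C) (reflected_trace C A B ?P)
      \<longleftrightarrow> r * z = q * y \<and> p * x = r * z \<and> q * y = p * x"
    if "x \<noteq> 0 \<or> y \<noteq> 0 \<or> z \<noteq> 0" for x y z
  proof -
    have "bary A B C x y z \<in> line_through (Ordinary A) (reflected_trace A B C ?P) \<longleftrightarrow> r * z = q * y"
      using assms that by (simp add: reflected_trace_bary mem_cevian_iff)
    moreover have "bary A B C x y z \<in> line_through (Ordinary B) (reflected_trace B C A ?P) \<longleftrightarrow> p * x = r * z"
      unfolding bary_rotate[of A B C] using assms that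
      by (subst BCA.reflected_trace_bary) (auto simp: BCA.mem_cevian_iff)
    moreover have "bary A B C x y z \<in> line_through (Ordinary C) (reflected_trace C A B ?P) \<longleftrightarrow> q * y = p * x"
      unfolding bary_rotate[of A B C] bary_rotate[of B C A] using assms that
      by (subst CAB.reflected_trace_bary) (auto simp: CAB.mem_cevian_iff)
    ultimately show ?thesis by blast
  qed
  show ?thesis
    unfolding isotomic_conjugate_def
  proof (rule the_equality)
    fix X assume X: "X \<in> line_through (Ordinary A) (reflected_trace A B C ?P) \<and>
      X \<in> line_through (Ordinary B) (reflected_trace B C A ?P) \<and>
      X \<in> line_through (Ordinary C) (reflected_trace C A B ?P)"
    obtain x y z where xyz: "x \<noteq> 0 \<or> y \<noteq> 0 \<or> z \<noteq> 0" "X = bary A B C x y z" by (rule bary_cases)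
    then have *: "q * y = p * x" "r * z = p * x" using X on_cevians[OF xyz(1)] by metis+
    then have "x \<noteq> 0" using xyz(1) assms by auto
    have "q * r / x * y = r * (q * y) / x" "q * r / x * z = q * (r * z) / x" by simp_all
    then have "q * r / x * x = q * r" "q * r / x * y = r * p" "q * r / x * z = p * q"
      unfolding * using \<open>x \<noteq> 0\<close> by simp_all
    then show "X = bary A B C (q * r) (r * p) (p * q)"
      using bary_scale[of "q * r / x" A B C x y z] assms \<open>x \<noteq> 0\<close> xyz by simp
  qed (use on_cevians[of "q * r" "r * p" "p * q"] assms in simp)
qed

lemma K_map_eq: "K_map A B C X = (-1/2) *\<^sub>R X + (1/2) *\<^sub>R (A + B + C)"
  by (simp add: K_map_def homothety_def centroid_def vector_2_eq_iff field_simps)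

text \<open>\<open>K\<close> takes each vertex to the midpoint of the opposite side.\<close>

lemma extend_K_map_bary:
  assumes "x \<noteq> 0 \<or> y \<noteq> 0 \<or> z \<noteq> 0"
  shows "extend (K_map A B C) (bary A B C x y z) = bary A B C (y + z) (z + x) (x + y)"
proof -
  have "affine_map (K_map A B C)"
    unfolding affine_map_def K_map_eq using linear_scale_self by blast
  then have "extend (K_map A B C) (bary A B C x y z) = bary (K_map A B C A) (K_map A B C B) (K_map A B C C) x y z"
    using assms by (rule extend_bary)
  also have "x *\<^sub>R lift (K_map A B C A) + y *\<^sub>R lift (K_map A B C B) + z *\<^sub>R lift (K_map A B C C)
    = (1/2) *\<^sub>R ((y + z) *\<^sub>R lift A + (z + x) *\<^sub>R lift B + (x + y) *\<^sub>R lift C)"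
    by (simp add: K_map_eq vector_3_eq_iff field_simps)
  then have "bary (K_map A B C A) (K_map A B C B) (K_map A B C C) x y z = bary A B C (y + z) (z + x) (x + y)"
    unfolding bary_def using point_of_scale[of "1/2"] by simp
  finally show ?thesis .
qed

lemma inv_K_map: "inv (K_map A B C) X = A + B + C - 2 *\<^sub>R X"
proof (rule inv_f_eq)
  show "inj (K_map A B C)" by (rule injI) (simp add: K_map_eq)
  show "K_map A B C (A + B + C - 2 *\<^sub>R X) = X"
    by (simp add: K_map_eq vector_2_eq_iff field_simps)
qed

lemma mem_sides_iff:
  assumes "p \<noteq> 0 \<or> q \<noteq> 0 \<or> r \<noteq> 0"
  shows "bary A B C p q r \<in> sides A B C \<longleftrightarrow> p = 0 \<or> q = 0 \<or> r = 0"
proof -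
  interpret BCA: triangle B C A by (rule rotate)
  interpret CAB: triangle C A B by (rule BCA.rotate)
  have "bary B C A q r p \<in> line_through (Ordinary C) (Ordinary A) \<longleftrightarrow> q = 0"
    "bary C A B r p q \<in> line_through (Ordinary A) (Ordinary B) \<longleftrightarrow> r = 0"
    using assms by (auto simp: BCA.mem_side_iff CAB.mem_side_iff)
  then show ?thesis
    using assms mem_side_iff[of p q r] bary_rotate[of A B C p q r] bary_rotate[of B C A q r p]
    by (simp add: sides_def)
qed

lemma mem_anticomplementary_sides_iff:
  assumes "p \<noteq> 0 \<or> q \<noteq> 0 \<or> r \<noteq> 0"
  shows "bary A B C p q r \<in> anticomplementary_sides A B C \<longleftrightarrow> q + r = 0 \<or> r + p = 0 \<or> p + q = 0"
proof -
  let ?K = "K_map A B C"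
  have "A + B + C - 2 *\<^sub>R A = B + C - A" "A + B + C - 2 *\<^sub>R B = C + A - B" "A + B + C - 2 *\<^sub>R C = A + B - C"
    by (simp_all add: scaleR_2)
  then have *: "Ordinary (inv ?K A) = bary A B C (-1) 1 1" "Ordinary (inv ?K B) = bary A B C 1 (-1) 1"
    "Ordinary (inv ?K C) = bary A B C 1 1 (-1)"
    by (simp_all add: inv_K_map bary_eq)
  have "2 * q + 2 * r = 0 \<longleftrightarrow> q + r = 0" "2 * p + 2 * r = 0 \<longleftrightarrow> r + p = 0"
    "2 * p + 2 * q = 0 \<longleftrightarrow> p + q = 0" by linarith+
  then show ?thesis
    using assms unfolding anticomplementary_sides_def sides_def Let_def *
    by (simp add: bary_mem_line_through_iff)
qed

lemma mem_medians_iff: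
  assumes "p \<noteq> 0 \<or> q \<noteq> 0 \<or> r \<noteq> 0"
  shows "bary A B C p q r \<in> medians A B C \<longleftrightarrow> q = r \<or> r = p \<or> p = q"
proof -
  have "Ordinary (centroid A B C) = bary A B C 1 1 1" by (simp add: centroid_def bary_eq)
  then show ?thesis
    using assms unfolding medians_def Let_def bary_vertex(1-3)[of A B C, symmetric]
    by (auto simp: bary_mem_line_through_iff simp del: bary_vertex)
qed

end

section \<open>Conics through the vertices of a triangle\<close>

lemma quadratic_form_scale: "quadratic_form M (k *\<^sub>R w) = k\<^sup>2 * quadratic_form M w"
  by (simp add: quadratic_form_def matrix_vector_mult_scaleR power2_eq_square)

lemma on_conic_point_of: "on_conic M (point_of w) \<longleftrightarrow> quadratic_form M w = 0" if w: "w \<noteq> 0"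
proof (cases "w$3 = 0")
  case True
  let ?v = "vector [w$1, w$2] :: real^2"
  have "?v \<noteq> 0" using w True by (simp add: vector_2_eq_iff vector_3_eq_iff)
  moreover have "vector [(k *\<^sub>R ?v)$1, (k *\<^sub>R ?v)$2, 0] = k *\<^sub>R w" for k
    using True by (simp add: vector_3_eq_iff)
  ultimately have "on_conic M (point_of w) \<longleftrightarrow> (\<forall>k. quadratic_form M (k *\<^sub>R w) = 0)"
    using True by (simp add: point_of_def Rep_direction_of span_singleton)
  then show ?thesis by (auto simp: quadratic_form_scale intro: spec[of _ 1])
next
  case False
  then have "vector [w$1 / w$3, w$2 / w$3, 1] = (1 / w$3) *\<^sub>R w"
    by (simp add: vector_3_eq_iff)
  then have "on_conic M (point_of w) \<longleftrightarrow> quadratic_form M ((1 / w$3) *\<^sub>R w) = 0"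
    using False by (simp add: point_of_def)
  then show ?thesis using False by (simp add: quadratic_form_scale)
qed

lemma symmetric_matrix_inner: "v \<bullet> (M *v w) = w \<bullet> (M *v v)" if "transpose M = M" for M :: "real^'n^'n"
  by (metis dot_lmul_matrix inner_commute that transpose_matrix_vector)

lemma quadratic_form_combination:
  assumes "transpose M = M"
  shows "quadratic_form M (x *\<^sub>R a + y *\<^sub>R b + z *\<^sub>R c)
    = x\<^sup>2 * quadratic_form M a + y\<^sup>2 * quadratic_form M b + z\<^sup>2 * quadratic_form M c
      + 2 * ((b \<bullet> (M *v c)) * y * z + (c \<bullet> (M *v a)) * z * x + (a \<bullet> (M *v b)) * x * y)"
  using symmetric_matrix_inner[OF assms, of c b] symmetric_matrix_inner[OF assms, of a c]
    symmetric_matrix_inner[OF assms, of b a]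
  unfolding quadratic_form_def
  by (simp add: matrix_vector_mult_scaleR matrix_vector_right_distrib inner_add_left inner_add_right
      power2_eq_square algebra_simps)

text \<open>By polarization, the bilinear form of \<open>M\<close> vanishes as well.\<close>

lemma quadratic_form_eq_0_imp:
  assumes "transpose M = M" "\<And>w. quadratic_form M w = 0"
  shows "M = 0"
proof -
  have "v \<bullet> (M *v w) = 0" for v w
    using quadratic_form_combination[OF assms(1), of 1 v 1 w 0 0] assms(2) by simp
  then have "M *v w = 0" for w by (metis inner_eq_zero_iff)
  then show ?thesis by (simp add: matrix_eq)
qed

definition circumconic :: "real^2 \<Rightarrow> real^2 \<Rightarrow> real^2 \<Rightarrow> real \<Rightarrow> real \<Rightarrow> real \<Rightarrow> point set" where
  "circumconic A B C a b c =
     {bary A B C x y z | x y z. (x \<noteq> 0 \<or> y \<noteq> 0 \<or> z \<noteq> 0) \<and> a * y * z + b * z * x + c * x * y = 0}"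

lemma circumconic_scale: "circumconic A B C (k * a) (k * b) (k * c) = circumconic A B C a b c" if "k \<noteq> 0"
proof -
  have "k * a * y * z + k * b * z * x + k * c * x * y = k * (a * y * z + b * z * x + c * x * y)" for x y z
    by (simp add: algebra_simps)
  then show ?thesis using that by (simp add: circumconic_def)
qed

context triangle
begin

text \<open>The factor \<open>k\<close> absorbs the scale of \<open>M\<close>, which the point set does not determine.\<close>

lemma conic_eq_circumconic:
  assumes "\<And>x y z. (x \<noteq> 0 \<or> y \<noteq> 0 \<or> z \<noteq> 0) \<Longrightarrow>
    quadratic_form M (x *\<^sub>R lift A + y *\<^sub>R lift B + z *\<^sub>R lift C) = k * (a * y * z + b * z * x + c * x * y)"
    and "k \<noteq> 0"
  shows "{X. on_conic M X} = circumconic A B C a b c"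
proof -
  have *: "on_conic M (bary A B C x y z) \<longleftrightarrow> a * y * z + b * z * x + c * x * y = 0"
    if "x \<noteq> 0 \<or> y \<noteq> 0 \<or> z \<noteq> 0" for x y z
    unfolding bary_def using assms that by (subst on_conic_point_of) (auto simp: combination_eq_0_iff)
  show ?thesis
  proof (intro set_eqI iffI)
    fix X assume "X \<in> {X. on_conic M X}"
    moreover obtain x y z where "x \<noteq> 0 \<or> y \<noteq> 0 \<or> z \<noteq> 0" "X = bary A B C x y z" by (rule bary_cases)
    ultimately show "X \<in> circumconic A B C a b c" using * unfolding circumconic_def by blast
  qed (use * in \<open>auto simp: circumconic_def\<close>)
qed

text \<open>The matrix \<open>M\<close> arises from the matrix \<open>N\<close> of twice the form in barycentric coordinates by
  the change of coordinates \<open>R\<close>, the dual basis up to a factor. Its determinant is a nonzero multiple of \<open>det N = 2abc\<close>.\<close>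

lemma nondegenerate_circumconic:
  assumes "a \<noteq> 0" "b \<noteq> 0" "c \<noteq> 0"
  shows "nondegenerate_conic (circumconic A B C a b c)"
proof -
  let ?a = "lift A" and ?b = "lift B" and ?c = "lift C"
  let ?d = "triple_product ?a ?b ?c"
  define R :: "real^3^3" where "R = vector [cross3 ?b ?c, cross3 ?c ?a, cross3 ?a ?b]"
  define N :: "real^3^3" where "N = vector [vector [0, c, b], vector [c, 0, a], vector [b, a, 0]]"
  define M where "M = transpose R ** N ** R"
  have R: "R *v (x *\<^sub>R ?a + y *\<^sub>R ?b + z *\<^sub>R ?c) = ?d *\<^sub>R vector [x, y, z]" for x y z
    using cross3_dual[of ?b ?c ?a]
    by (simp add: vector_3_eq_iff matrix_vector_mul_component R_def inner_add_right)
  have "transpose N = N" by (simp add: transpose_def N_def vec_eq_iff forall_3)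
  then have "transpose M = M" unfolding M_def by (simp add: matrix_transpose_mul matrix_mul_assoc)
  have "det R = cross3 ?b ?c \<bullet> cross3 (cross3 ?c ?a) (cross3 ?a ?b)"
    by (simp add: R_def dot_cross_det)
  also have "\<dots> = det (vector [?c, ?a, ?b]) * ?d"
    using cross3_dual[of ?b ?c ?a] by (simp add: cross_cross_det inner_diff_right) 
  also have "\<dots> = ?d\<^sup>2"
    using cross3_dual[of ?b ?c ?a] by (simp add: dot_cross_det[symmetric] inner_commute power2_eq_square)
  finally have "det R \<noteq> 0" using triple_lift_nonzero by simp
  moreover have "det N = 2 * a * b * c" by (simp add: N_def det_3)
  ultimately have "det M \<noteq> 0" using assms by (simp add: M_def det_mul)
  have "quadratic_form M (x *\<^sub>R ?a + y *\<^sub>R ?b + z *\<^sub>R ?c) = 2 * ?d\<^sup>2 * (a * y * z + b * z * x + c * x * y)"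
    for x y z
  proof -
    have form: "quadratic_form M w = (R *v w) \<bullet> (N *v (R *v w))" for w
      unfolding quadratic_form_def M_def
      by (metis dot_lmul_matrix matrix_vector_mul_assoc transpose_matrix_vector inner_commute)
    moreover have "N *v vector [x, y, z] = vector [c * y + b * z, c * x + a * z, b * x + a * y]"
      by (simp add: vector_3_eq_iff matrix_vector_mul_component N_def inner_3)
    ultimately show ?thesis
      unfolding form R by (simp add: matrix_vector_mult_scaleR inner_3 power2_eq_square algebra_simps)
  qed
  then have "{X. on_conic M X} = circumconic A B C a b c"
    by (intro conic_eq_circumconic[where k = "2 * ?d\<^sup>2"]) (use triple_lift_nonzero in auto)
  then show ?thesis
    unfolding nondegenerate_conic_def using \<open>transpose M = M\<close> \<open>det M \<noteq> 0\<close> by blast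
qed

text \<open>Passing through the vertices kills the three squares of the form in barycentric
  coordinates. If the three mixed terms vanished as well, the matrix would be zero.\<close>

lemma nondegenerate_conic_through_vertices:
  assumes "nondegenerate_conic S" "{Ordinary A, Ordinary B, Ordinary C} \<subseteq> S"
  obtains a b c where "a \<noteq> 0 \<or> b \<noteq> 0 \<or> c \<noteq> 0" "S = circumconic A B C a b c"
    "\<And>x y z. (x \<noteq> 0 \<or> y \<noteq> 0 \<or> z \<noteq> 0) \<Longrightarrow> bary A B C x y z \<in> S \<longleftrightarrow> a * y * z + b * z * x + c * x * y = 0"
proof -
  obtain M where M: "transpose M = M" "det M \<noteq> 0" and S: "S = {X. on_conic M X}"
    using assms(1) by (auto simp: nondegenerate_conic_def)
  let ?a = "lift A" and ?b = "lift B" and ?c = "lift C"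
  have vertex: "quadratic_form M (lift X) = 0" if "Ordinary X \<in> S" for X
  proof -
    have "lift X \<noteq> 0" by (simp add: vector_3_eq_iff)
    then show ?thesis using that on_conic_point_of[of "lift X" M] by (simp add: S)
  qed
  have form: "quadratic_form M (x *\<^sub>R ?a + y *\<^sub>R ?b + z *\<^sub>R ?c)
    = 2 * ((?b \<bullet> (M *v ?c)) * y * z + (?c \<bullet> (M *v ?a)) * z * x + (?a \<bullet> (M *v ?b)) * x * y)" for x y z
    unfolding quadratic_form_combination[OF M(1)] using vertex assms(2) by simp
  show ?thesis
  proof (rule that)
    show "?b \<bullet> (M *v ?c) \<noteq> 0 \<or> ?c \<bullet> (M *v ?a) \<noteq> 0 \<or> ?a \<bullet> (M *v ?b) \<noteq> 0"
    proof (rule ccontr)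
      assume "\<not> ?thesis"
      then have "quadratic_form M w = 0" for w
        using form combination_cases[of w] by (metis add_0 mult_zero_left mult_zero_right)
      then have "M = 0" using quadratic_form_eq_0_imp M(1) by blast
      then show False using M(2) by (simp add: det_3)
    qed
    show "S = circumconic A B C (?b \<bullet> (M *v ?c)) (?c \<bullet> (M *v ?a)) (?a \<bullet> (M *v ?b))"
      unfolding S by (rule conic_eq_circumconic[where k = 2]) (simp_all add: form)
    fix x y z :: real assume "x \<noteq> 0 \<or> y \<noteq> 0 \<or> z \<noteq> 0"
    then show "bary A B C x y z \<in> S \<longleftrightarrow>
      (?b \<bullet> (M *v ?c)) * y * z + (?c \<bullet> (M *v ?a)) * z * x + (?a \<bullet> (M *v ?b)) * x * y = 0"
      unfolding S bary_def by (simp add: on_conic_point_of combination_eq_0_iff form del: distrib_left_numeral)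
  qed
qed

section \<open>The invariant conic\<close>

text \<open>Eliminating one coefficient from the two linear conditions imposed by \<open>P\<close> and \<open>Q\<close> shows
  that \<open>(a : b : c)\<close> is unique. The three hypotheses on \<open>p, q, r\<close> together make all coefficients
  nonzero, hence the conic nondegenerate.\<close>

lemma conic_C_bary:
  assumes nz: "p \<noteq> 0" "q \<noteq> 0" "r \<noteq> 0" and sums: "q + r \<noteq> 0" "r + p \<noteq> 0" "p + q \<noteq> 0"
    and diffs: "q \<noteq> r" "r \<noteq> p" "p \<noteq> q"
  shows "conic_C A B C (bary A B C p q r)
    = circumconic A B C (p * (q\<^sup>2 - r\<^sup>2)) (q * (r\<^sup>2 - p\<^sup>2)) (r * (p\<^sup>2 - q\<^sup>2))"
proof -
  let ?P = "bary A B C p q r" and ?Q = "bary A B C (p * (q + r)) (q * (r + p)) (r * (p + q))"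
  let ?a = "p * (q\<^sup>2 - r\<^sup>2)" and ?b = "q * (r\<^sup>2 - p\<^sup>2)" and ?c = "r * (p\<^sup>2 - q\<^sup>2)"
  have coefficients: "?a \<noteq> 0" "?b \<noteq> 0" "?c \<noteq> 0"
    using nz sums diffs by (auto simp: power2_eq_iff add_eq_0_iff)
  have "extend (K_map A B C) (isotomic_conjugate A B C ?P)
      = bary A B C (r * p + p * q) (p * q + q * r) (q * r + r * p)"
    using nz by (simp add: isotomic_conjugate_bary extend_K_map_bary)
  then have Q: "extend (K_map A B C) (isotomic_conjugate A B C ?P) = ?Q"
    by (simp add: algebra_simps)
  show ?thesis
    unfolding conic_C_def Let_def Q
  proof (rule the_equality)
    have "{Ordinary A, Ordinary B, Ordinary C} \<subseteq> circumconic A B C ?a ?b ?c"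
      unfolding circumconic_def bary_vertex[of A B C, symmetric] by fastforce
    moreover have "?P \<in> circumconic A B C ?a ?b ?c"
      unfolding circumconic_def using nz
      by (intro CollectI exI conjI[OF refl] conjI) (auto simp: algebra_simps power2_eq_square)
    moreover have "?Q \<in> circumconic A B C ?a ?b ?c"
    proof -
      have "?a * (q * (r + p)) * (r * (p + q)) + ?b * (r * (p + q)) * (p * (q + r))
        + ?c * (p * (q + r)) * (q * (r + p)) = 0"
        by algebra
      moreover have "p * (q + r) \<noteq> 0" using nz(1) sums(1) by simp
      ultimately show ?thesis unfolding circumconic_def by blast
    qed
    ultimately show "nondegenerate_conic (circumconic A B C ?a ?b ?c) \<and>
        {Ordinary A, Ordinary B, Ordinary C, ?P, ?Q} \<subseteq> circumconic A B C ?a ?b ?c"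
      using nondegenerate_circumconic[OF coefficients] by simp
  next
    fix S assume S: "nondegenerate_conic S \<and> {Ordinary A, Ordinary B, Ordinary C, ?P, ?Q} \<subseteq> S"
    then obtain a b c where abc: "a \<noteq> 0 \<or> b \<noteq> 0 \<or> c \<noteq> 0" "S = circumconic A B C a b c"
      and mem: "\<And>x y z. (x \<noteq> 0 \<or> y \<noteq> 0 \<or> z \<noteq> 0) \<Longrightarrow>
        bary A B C x y z \<in> S \<longleftrightarrow> a * y * z + b * z * x + c * x * y = 0"
      using nondegenerate_conic_through_vertices[of S] by auto
    have onP: "a * q * r + b * r * p + c * p * q = 0"
      using mem[of p q r] S nz by simp
    have onQ: "a * (q * (r + p)) * (r * (p + q)) + b * (r * (p + q)) * (p * (q + r))
        + c * (p * (q + r)) * (q * (r + p)) = 0"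
      using mem[of "p * (q + r)" "q * (r + p)" "r * (p + q)"] S nz sums by simp
    (* These are combinations of the two conditions: the first eliminates c, the second b. *)
    have "r * (b * ?a - a * ?b) = 0" "q * (c * ?a - a * ?c) = 0"
      using onP onQ by algebra+
    then have "b * ?a = a * ?b" "c * ?a = a * ?c"
      using nz by simp_all
    then have "a = a / ?a * ?a" "b = a / ?a * ?b" "c = a / ?a * ?c"
      using coefficients by (simp_all only: times_divide_eq_left nonzero_eq_divide_eq not_False_eq_True) 
    moreover from this have "a / ?a \<noteq> 0" using abc(1) by (metis mult_zero_left)
    ultimately show "S = circumconic A B C ?a ?b ?c"
      unfolding abc(2) using circumconic_scale[of "a / ?a" A B C ?a ?b ?c] by metis
  qed
qed

text \<open>The lift of \<open>D\<close> is \<open>(y1 b + z1 c) / s\<close> with \<open>b, c\<close> the lifts of \<open>B, C\<close>, and similarly for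
  \<open>E\<close> and \<open>F\<close>; the weights \<open>s, t, u\<close> cancel these denominators. Used once for the traces of \<open>P\<close>
  and once for their reflections, with the same weights.\<close>

lemma bary_inscribed_triangle:
  assumes "s \<noteq> 0" "t \<noteq> 0" "u \<noteq> 0"
    and D: "Ordinary D = bary A B C 0 y1 z1" "y1 + z1 = s"
    and E: "Ordinary E = bary A B C x2 0 z2" "z2 + x2 = t"
    and F: "Ordinary F = bary A B C x3 y3 0" "x3 + y3 = u"
  shows "bary D E F (s * x) (t * y) (u * z)
    = bary A B C (x2 * y + x3 * z) (y3 * z + y1 * x) (z1 * x + z2 * y)"
    and "y1 * z2 * x3 + z1 * x2 * y3 \<noteq> 0 \<Longrightarrow> triangle D E F"
proof -
  have "D = (1 / s) *\<^sub>R (y1 *\<^sub>R B + z1 *\<^sub>R C)" "E = (1 / t) *\<^sub>R (x2 *\<^sub>R A + z2 *\<^sub>R C)"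
    "F = (1 / u) *\<^sub>R (x3 *\<^sub>R A + y3 *\<^sub>R B)"
    using assms by (simp_all add: bary_eq add.commute split: if_splits)
  then have lifts: "lift D = (0 / s) *\<^sub>R lift A + (y1 / s) *\<^sub>R lift B + (z1 / s) *\<^sub>R lift C"
    "lift E = (x2 / t) *\<^sub>R lift A + (0 / t) *\<^sub>R lift B + (z2 / t) *\<^sub>R lift C"
    "lift F = (x3 / u) *\<^sub>R lift A + (y3 / u) *\<^sub>R lift B + (0 / u) *\<^sub>R lift C"
    using assms by (simp_all add: vector_3_eq_iff flip: add_divide_distrib)
  show "bary D E F (s * x) (t * y) (u * z)
    = bary A B C (x2 * y + x3 * z) (y3 * z + y1 * x) (z1 * x + z2 * y)"
    using assms(1-3) unfolding bary_def lifts by (simp add: scaleR_add_right scaleR_add_left algebra_simps)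
  (* The determinant of the coordinates of D, E, F; for the traces of P it is 2pqr. *)
  assume "y1 * z2 * x3 + z1 * x2 * y3 \<noteq> 0"
  moreover have "triple_product (lift D) (lift E) (lift F)
      = (y1 * z2 * x3 + z1 * x2 * y3) / (s * t * u) * triple_product (lift A) (lift B) (lift C)"
    unfolding lifts triple_product_combinations by (simp add: add_divide_distrib mult_ac)
  ultimately show "triangle D E F"
    using assms(1-3) triple_lift_nonzero by (simp add: triangle_def)
qed

text \<open>The heart of the proof: two different substitutions, both invertible, turn the equation
  of the conic into the same diagonal equation.\<close>

lemma circumconic_parametrizations:
  assumes nz: "p \<noteq> 0" "q \<noteq> 0" "r \<noteq> 0"
  defines "S \<equiv> circumconic A B C (p * (q\<^sup>2 - r\<^sup>2)) (q * (r\<^sup>2 - p\<^sup>2)) (r * (p\<^sup>2 - q\<^sup>2))"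
    and "V \<equiv> {(x, y, z). (x \<noteq> 0 \<or> y \<noteq> 0 \<or> z \<noteq> 0) \<and> (q\<^sup>2 - r\<^sup>2) * x\<^sup>2 + (r\<^sup>2 - p\<^sup>2) * y\<^sup>2 + (p\<^sup>2 - q\<^sup>2) * z\<^sup>2 = 0}"
  shows "S = (\<lambda>(x, y, z). bary A B C (p * y + p * z) (q * z + q * x) (r * x + r * y)) ` V"
    and "S = (\<lambda>(x, y, z). bary A B C (r * y + q * z) (p * z + r * x) (q * x + p * y)) ` V"
proof -
  let ?form = "\<lambda>X Y Z. p * (q\<^sup>2 - r\<^sup>2) * Y * Z + q * (r\<^sup>2 - p\<^sup>2) * Z * X + r * (p\<^sup>2 - q\<^sup>2) * X * Y"
  let ?diag = "\<lambda>x y z. (q\<^sup>2 - r\<^sup>2) * x\<^sup>2 + (r\<^sup>2 - p\<^sup>2) * y\<^sup>2 + (p\<^sup>2 - q\<^sup>2) * z\<^sup>2"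
  have image: "S = (\<lambda>(x, y, z). bary A B C (f x y z) (g x y z) (h x y z)) ` V"
    if surj: "\<And>X Y Z. \<exists>x y z. X = f x y z \<and> Y = g x y z \<and> Z = h x y z"
      and form: "\<And>x y z. ?form (f x y z) (g x y z) (h x y z) = p * q * r * ?diag x y z"
      and zero: "\<And>x y z. f x y z = 0 \<and> g x y z = 0 \<and> h x y z = 0 \<longleftrightarrow> x = 0 \<and> y = 0 \<and> z = 0"
    for f g h
  proof (intro set_eqI iffI)
    fix W assume "W \<in> S"
    then obtain X Y Z where W: "W = bary A B C X Y Z" "X \<noteq> 0 \<or> Y \<noteq> 0 \<or> Z \<noteq> 0" "?form X Y Z = 0"
      unfolding S_def circumconic_def by blast
    then obtain x y z where xyz: "X = f x y z" "Y = g x y z" "Z = h x y z" using surj by blast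
    then have "?diag x y z = 0" using W(3) form[of x y z] nz by simp
    moreover have "x \<noteq> 0 \<or> y \<noteq> 0 \<or> z \<noteq> 0" using W(2) xyz zero[of x y z] by blast
    ultimately have "(x, y, z) \<in> V" unfolding V_def by blast
    then show "W \<in> (\<lambda>(x, y, z). bary A B C (f x y z) (g x y z) (h x y z)) ` V"
      using W(1) xyz by force
  next
    fix W assume "W \<in> (\<lambda>(x, y, z). bary A B C (f x y z) (g x y z) (h x y z)) ` V"
    then obtain x y z where W: "W = bary A B C (f x y z) (g x y z) (h x y z)"
      "x \<noteq> 0 \<or> y \<noteq> 0 \<or> z \<noteq> 0" "?diag x y z = 0"
      unfolding V_def by auto
    then have "?form (f x y z) (g x y z) (h x y z) = 0" using form[of x y z] by simp
    moreover have "f x y z \<noteq> 0 \<or> g x y z \<noteq> 0 \<or> h x y z \<noteq> 0" using W(2) zero[of x y z] by blast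
    ultimately show "W \<in> S" unfolding S_def circumconic_def W(1) by blast
  qed
  show "S = (\<lambda>(x, y, z). bary A B C (p * y + p * z) (q * z + q * x) (r * x + r * y)) ` V"
  proof (rule image)
    fix X Y Z
    (* Two of X/p, Y/q, Z/r minus the third give twice one of the unknowns. *)
    show "\<exists>x y z. X = p * y + p * z \<and> Y = q * z + q * x \<and> Z = r * x + r * y"
      using nz
      by (intro exI[of _ "(Y / q + Z / r - X / p) / 2"] exI[of _ "(Z / r + X / p - Y / q) / 2"]
          exI[of _ "(X / p + Y / q - Z / r) / 2"]) (simp add: field_simps)
  next
    fix x y z
    show "?form (p * y + p * z) (q * z + q * x) (r * x + r * y) = p * q * r * ?diag x y z"
      by algebra
    have "(y + z = 0 \<and> z + x = 0 \<and> x + y = 0) = (x = 0 \<and> y = 0 \<and> z = 0)" by auto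
    then show "(p * y + p * z = 0 \<and> q * z + q * x = 0 \<and> r * x + r * y = 0) = (x = 0 \<and> y = 0 \<and> z = 0)"
      using nz by (simp flip: distrib_left)
  qed
  show "S = (\<lambda>(x, y, z). bary A B C (r * y + q * z) (p * z + r * x) (q * x + p * y)) ` V"
  proof (rule image)
    fix X Y Z
    (* Likewise for pX, qY, rZ, which are sums of two of qrx, rpy, pqz. *)
    show "\<exists>x y z. X = r * y + q * z \<and> Y = p * z + r * x \<and> Z = q * x + p * y"
      using nz
      by (intro exI[of _ "(q * Y + r * Z - p * X) / (2 * q * r)"]
          exI[of _ "(r * Z + p * X - q * Y) / (2 * r * p)"]
          exI[of _ "(p * X + q * Y - r * Z) / (2 * p * q)"]) (simp add: field_simps)
  next
    fix x y z
    show "?form (r * y + q * z) (p * z + r * x) (q * x + p * y) = p * q * r * ?diag x y z"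
      by algebra
    show "(r * y + q * z = 0 \<and> p * z + r * x = 0 \<and> q * x + p * y = 0) = (x = 0 \<and> y = 0 \<and> z = 0)"
    proof
      assume *: "r * y + q * z = 0 \<and> p * z + r * x = 0 \<and> q * x + p * y = 0"
      then have "2 * q * r * x = 0" "2 * r * p * y = 0" "2 * p * q * z = 0" by algebra+
      then show "x = 0 \<and> y = 0 \<and> z = 0" using nz by simp
    qed simp
  qed
qed

end

theorem theorem3p2:
  fixes A B C :: "real^2" and P :: point
  assumes "\<not> collinear {A, B, C}"
    and "P \<notin> sides A B C"
    and "P \<notin> anticomplementary_sides A B C"
    and "P \<notin> medians A B C"
  shows "extend (T_map' A B C P \<circ> inv (T_map A B C P)) ` conic_C A B C P = conic_C A B C P"
proof -
  interpret ABC: triangle A B C using assms(1) by (rule triangle_if_not_collinear)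
  interpret BCA: triangle B C A by (rule ABC.rotate)
  interpret CAB: triangle C A B by (rule BCA.rotate)
  obtain p q r where P: "p \<noteq> 0 \<or> q \<noteq> 0 \<or> r \<noteq> 0" "P = bary A B C p q r" by (rule ABC.bary_cases)
  have nz: "p \<noteq> 0" "q \<noteq> 0" "r \<noteq> 0"
    using assms(2) P ABC.mem_sides_iff by auto
  have sums: "q + r \<noteq> 0" "r + p \<noteq> 0" "p + q \<noteq> 0"
    using assms(3) P ABC.mem_anticomplementary_sides_iff by auto
  have diffs: "q \<noteq> r" "r \<noteq> p" "p \<noteq> q"
    using assms(4) P ABC.mem_medians_iff by auto
  have P': "bary A B C p q r = bary B C A q r p" "bary A B C p q r = bary C A B r p q"
    by (rule bary_rotate bary_rotate')+
  have ordinary: "\<exists>X. bary A B C x y z = Ordinary X" if "x + y + z \<noteq> 0" for x y z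
    using that by (simp add: bary_eq)
  obtain D E F where traces: "Ordinary D = bary A B C 0 q r" "Ordinary E = bary A B C p 0 r"
      "Ordinary F = bary A B C p q 0"
    using ordinary[of 0 q r] ordinary[of p 0 r] ordinary[of p q 0] sums by (metis add.commute add_0 add_0_right)
  obtain D' E' F' where reflected: "Ordinary D' = bary A B C 0 r q" "Ordinary E' = bary A B C r 0 p"
      "Ordinary F' = bary A B C q p 0"
    using ordinary[of 0 r q] ordinary[of r 0 p] ordinary[of q p 0] sums by (metis add.commute add_0 add_0_right)
  have cevian_traces: "cevian_trace A B C P = Ordinary D" "cevian_trace B C A P = Ordinary E"
    "cevian_trace C A B P = Ordinary F"
    unfolding traces bary_rotate[of A B C p 0 r] bary_rotate'[of A B C p q 0]
    using nz ABC.cevian_trace_bary[of q p r] BCA.cevian_trace_bary[of r q p] CAB.cevian_trace_bary[of p r q]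
    by (simp_all add: P(2) flip: P')
  have reflected_traces: "reflected_trace A B C P = Ordinary D'" "reflected_trace B C A P = Ordinary E'"
    "reflected_trace C A B P = Ordinary F'"
    unfolding reflected bary_rotate[of A B C r 0 p] bary_rotate'[of A B C q p 0]
    using nz ABC.reflected_trace_bary[of q p r] BCA.reflected_trace_bary[of r q p] CAB.reflected_trace_bary[of p r q]
    by (simp_all add: P(2) flip: P')
  interpret DEF: triangle D E F
    using ABC.bary_inscribed_triangle(2)[OF sums traces(1) refl traces(2) _ traces(3) refl] nz
    by (simp add: mult_ac)
  obtain T where T: "T_map A B C P = T" "affine_map T" "T A = D" "T B = E" "T C = F"
    unfolding T_map_def cevian_traces by (rule ABC.affine_map_taking)
  obtain T' where T': "T_map' A B C P = T'" "affine_map T'" "T' A = D'" "T' B = E'" "T' C = F'"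
    unfolding T_map'_def reflected_traces by (rule ABC.affine_map_taking)
  (* S is the inverse of T; building it from the triangle DEF shows that T is bijective. *)
  obtain S where S: "affine_map S" "S D = A" "S E = B" "S F = C"
    by (rule DEF.affine_map_exists)
  have "S \<circ> T = id" 
    using S T by (intro ABC.affine_map_eqI affine_map_compose affine_map_id) simp_all
  moreover have "T \<circ> S = id" 
    using S T by (intro DEF.affine_map_eqI affine_map_compose affine_map_id) simp_all
  ultimately have "inv T = S" by (rule inv_unique_comp[rotated])
  then have on_DEF: "affine_map (T' \<circ> inv T)" "(T' \<circ> inv T) D = D'" "(T' \<circ> inv T) E = E'" "(T' \<circ> inv T) F = F'"
    using S T' affine_map_compose by auto
  define l where "l = T' \<circ> inv T"
  let ?V = "{(x, y, z). (x \<noteq> 0 \<or> y \<noteq> 0 \<or> z \<noteq> 0) \<and>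
    (q\<^sup>2 - r\<^sup>2) * x\<^sup>2 + (r\<^sup>2 - p\<^sup>2) * y\<^sup>2 + (p\<^sup>2 - q\<^sup>2) * z\<^sup>2 = 0}"
  (* The map keeps coordinates while the reference triangle changes from DEF to D'E'F'. *)
  have "extend l (bary A B C (p * y + p * z) (q * z + q * x) (r * x + r * y))
      = bary A B C (r * y + q * z) (p * z + r * x) (q * x + p * y)"
    if "x \<noteq> 0 \<or> y \<noteq> 0 \<or> z \<noteq> 0" for x y z
  proof -
    have "bary A B C (p * y + p * z) (q * z + q * x) (r * x + r * y)
        = bary D E F ((q + r) * x) ((r + p) * y) ((p + q) * z)"
      by (rule ABC.bary_inscribed_triangle(1)[symmetric]) (use traces sums in \<open>simp_all add: add.commute\<close>)
    then have "extend l (bary A B C (p * y + p * z) (q * z + q * x) (r * x + r * y))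
        = bary D' E' F' ((q + r) * x) ((r + p) * y) ((p + q) * z)"
      using that sums on_DEF by (simp add: DEF.extend_bary l_def)
    also have "\<dots> = bary A B C (r * y + q * z) (p * z + r * x) (q * x + p * y)"
      by (rule ABC.bary_inscribed_triangle(1)) (use reflected sums in \<open>simp_all add: add.commute\<close>)
    finally show ?thesis .
  qed
  then have "extend l ` (\<lambda>(x, y, z). bary A B C (p * y + p * z) (q * z + q * x) (r * x + r * y)) ` ?V
      = (\<lambda>(x, y, z). bary A B C (r * y + q * z) (p * z + r * x) (q * x + p * y)) ` ?V"
    unfolding image_image by (intro image_cong) auto
  then have "extend l ` conic_C A B C P = conic_C A B C P"
    unfolding P(2) ABC.conic_C_bary[OF nz sums diffs]
    by (metis ABC.circumconic_parametrizations[OF nz])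
  then show ?thesis by (simp only: T(1) T'(1) l_def)
qed

end
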